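(* Let $(X,d)$ be a non-compact, uniformly smooth, locally compact (proper geodesic) metric space. Then $X$ admits a quasi-convex exhaustion function $b:X\to\mathbb{R}$ with compact sublevel sets such that $S=b^{-1}(\min b)$ has empty interior.
   Context: A geodesic from $x$ to $y$ is a map $\gamma:[0,1]\to X$ with $\gamma(0)=x$, $\gamma(1)=y$ and $d(\gamma(t),\gamma(s))=|t-s|\,d(x,y)$; $X$ is geodesic if any two points are joined by a geodesic, and proper if closed bounded subsets are compact. A midpoint of $y,z$ is a point $m$ with $d(y,m)=d(m,z)=\frac12d(y,z)$. $(X,d)$ is uniformly smooth if there is a non-decreasing function $\rho:(0,\infty)\to[0,\infty)$ with $\rho(\epsilon)/\epsilon\to0$ as $\epsilon\to0$ such that for all $\epsilon>0$ and all $x,y,z\in X$ with $d(y,z)\le\epsilon\min\{d(x,y),d(x,z)\}$ and every midpoint $m$ of $y$ and $z$, $d(x,m)\ge(1-\rho(\epsilon))\min\{d(x,y),d(x,z)\}$. A function $f:X\to\mathbb{R}$ is quasi-convex if $f(\gamma(t))\le\max\{f(\gamma(0)),f(\gamma(1))\}$ for every geodesic $\gamma:[0,1]\to X$ and $t\in[0,1]$. An exhaustion function is a continuous function $b:X\to\mathbb{R}$ all of whose sublevel sets $b^{-1}((-\infty,s])$ are compact. *)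

theory Defs
  imports "HOL-Analysis.Analysis"
begin

text \<open>The metric space \<open>X\<close> is the whole type \<open>'a\<close>. A geodesic is a function on all of
  \<open>real\<close>, of which only the values on \<open>[0,1]\<close> matter.\<close>

definition geodesic_from_to :: "(real \<Rightarrow> 'a::metric_space) \<Rightarrow> 'a \<Rightarrow> 'a \<Rightarrow> bool" where
  "geodesic_from_to \<gamma> x y \<longleftrightarrow> \<gamma> 0 = x \<and> \<gamma> 1 = y \<and>
     (\<forall>t\<in>{0..1}. \<forall>s\<in>{0..1}. dist (\<gamma> t) (\<gamma> s) = \<bar>t - s\<bar> * dist x y)"

definition geodesic_space :: "'a::metric_space itself \<Rightarrow> bool" where
  "geodesic_space _ \<longleftrightarrow> (\<forall>x y :: 'a. \<exists>\<gamma>. geodesic_from_to \<gamma> x y)"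

definition proper_space :: "'a::metric_space itself \<Rightarrow> bool" where
  "proper_space _ \<longleftrightarrow> (\<forall>A :: 'a set. closed A \<and> bounded A \<longrightarrow> compact A)"

definition is_midpoint :: "'a::metric_space \<Rightarrow> 'a \<Rightarrow> 'a \<Rightarrow> bool" where
  "is_midpoint m y z \<longleftrightarrow> dist y m = dist y z / 2 \<and> dist m z = dist y z / 2"

text \<open>The modulus \<open>\<rho> : (0,\<infinity>) \<rightarrow> [0,\<infinity>)\<close> is a total function constrained only on the positive
  reals.\<close>

definition uniformly_smooth :: "'a::metric_space itself \<Rightarrow> bool" where
  "uniformly_smooth _ \<longleftrightarrow>
     (\<exists>\<rho> :: real \<Rightarrow> real.
        (\<forall>\<epsilon>>0. \<rho> \<epsilon> \<ge> 0) \<and> mono_on {0<..} \<rho> \<and>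
        ((\<lambda>\<epsilon>. \<rho> \<epsilon> / \<epsilon>) \<longlongrightarrow> 0) (at_right 0) \<and>
        (\<forall>\<epsilon>>0. \<forall>x y z :: 'a.
           dist y z \<le> \<epsilon> * min (dist x y) (dist x z) \<longrightarrow>
           (\<forall>m. is_midpoint m y z \<longrightarrow>
              dist x m \<ge> (1 - \<rho> \<epsilon>) * min (dist x y) (dist x z))))"

definition quasi_convex :: "('a::metric_space \<Rightarrow> real) \<Rightarrow> bool" where
  "quasi_convex f \<longleftrightarrow>
     (\<forall>\<gamma> x y. geodesic_from_to \<gamma> x y \<longrightarrow>
        (\<forall>t\<in>{0..1}. f (\<gamma> t) \<le> max (f (\<gamma> 0)) (f (\<gamma> 1))))"

definition exhaustion_function :: "('a::metric_space \<Rightarrow> real) \<Rightarrow> bool" where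
  "exhaustion_function b \<longleftrightarrow> continuous_on UNIV b \<and> (\<forall>s. compact (b -` {..s}))"

end

theory Submission
  imports Defs
begin

text \<open>Fix a base point \<open>w\<close> and let \<open>b x\<close> be the limit superior of \<open>d(p,w) - d(p,x)\<close> as \<open>p\<close> goes
  to infinity. By uniform smoothness \<open>d(p,m)\<close> is at least \<open>min (d(p,y)) (d(p,z))\<close> up to an error
  \<open>(\<rho>(\<epsilon>)/\<epsilon>) d(y,z)\<close>, where \<open>\<epsilon> = d(y,z) / min (d(p,y)) (d(p,z))\<close> tends to \<open>0\<close>, so \<open>b\<close> is
  quasi-convex. If a sublevel set of
  \<open>b\<close> contained points \<open>p\<close> arbitrarily far away, it would contain the points at distance \<open>t\<close> from
  \<open>w\<close> on the geodesics from \<open>w\<close> to \<open>p\<close>; these accumulate at some \<open>q\<close> with \<open>b q \<ge> t\<close>, which is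
  absurd for large \<open>t\<close>. The same limit argument, with geodesics from any \<open>x\<close> to points \<open>p\<close> that
  almost realise the limit superior, yields \<open>q\<close> at distance \<open>t\<close> from \<open>x\<close> with \<open>b q \<ge> b x + t\<close>, so
  no level set of \<open>b\<close> has interior points.\<close>

section \<open>Limit superior of distance differences: bounds and Lipschitz continuity\<close>

text \<open>The limit superior is encoded as the infimum of all eventual upper bounds, so that it
  lives in \<open>real\<close>; in an unbounded space the triangle inequality keeps it between
  \<open>- dist w x\<close> and \<open>dist w x\<close>.\<close>

definition busemann_sup :: "'a::metric_space \<Rightarrow> 'a \<Rightarrow> real" where
  "busemann_sup w x = Inf {s. \<exists>R. \<forall>p. R \<le> dist p w \<longrightarrow> dist p w - dist p x \<le> s}"

lemma unbounded_obtains_far: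
  assumes "\<not> bounded (UNIV :: 'a::metric_space set)"
  obtains p :: "'a::metric_space" where "R \<le> dist p w"
proof -
  have "\<not> (\<forall>p. dist w p \<le> R)"
    using assms by (auto simp: bounded_def)
  with that show thesis
    by (metis dist_commute linear)
qed

text \<open>Unboundedness rules out vacuous bounds: every eventual bound can be tested at some far
  point, where the difference is at least \<open>- dist w x\<close>.\<close>

lemma busemann_sup_bdd_below:
  assumes "\<not> bounded (UNIV :: 'a::metric_space set)"
  shows "bdd_below {s. \<exists>R. \<forall>p::'a. R \<le> dist p w \<longrightarrow> dist p w - dist p x \<le> s}"
proof (rule bdd_belowI)
  fix s assume "s \<in> {s. \<exists>R. \<forall>p::'a. R \<le> dist p w \<longrightarrow> dist p w - dist p x \<le> s}"
  then obtain R where R: "\<And>p::'a. R \<le> dist p w \<Longrightarrow> dist p w - dist p x \<le> s"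
    by auto
  obtain p :: 'a where "R \<le> dist p w"
    using unbounded_obtains_far[OF assms] .
  from R[OF this] show "- dist w x \<le> s"
    using dist_triangle[of p x w] by linarith
qed

lemma busemann_sup_le:
  assumes "\<not> bounded (UNIV :: 'a::metric_space set)"
    and "\<And>p::'a. R \<le> dist p w \<Longrightarrow> dist p w - dist p x \<le> s"
  shows "busemann_sup w x \<le> s"
  unfolding busemann_sup_def
  using assms(2) by (intro cInf_lower busemann_sup_bdd_below assms(1)) auto

lemma busemann_sup_lessD:
  assumes "busemann_sup w x < s"
  obtains R where "\<And>p. R \<le> dist p w \<Longrightarrow> dist p w - dist p x \<le> s"
proof -
  have "dist p w - dist p x \<le> dist w x" for p
    using dist_triangle[of p w x] by (simp add: dist_commute)
  then have "dist w x \<in> {s. \<exists>R. \<forall>p. R \<le> dist p w \<longrightarrow> dist p w - dist p x \<le> s}"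
    by simp
  then have "{s. \<exists>R. \<forall>p. R \<le> dist p w \<longrightarrow> dist p w - dist p x \<le> s} \<noteq> {}"
    by (metis (no_types) empty_iff)
  from cInf_lessD[OF this assms[unfolded busemann_sup_def]]
  obtain s' R where "s' < s" and R: "\<And>p. R \<le> dist p w \<Longrightarrow> dist p w - dist p x \<le> s'"
    by auto
  have "dist p w - dist p x \<le> s" if "R \<le> dist p w" for p
    using R[OF that] \<open>s' < s\<close> by linarith
  with that show thesis .
qed

lemma busemann_sup_base_le:
  assumes "\<not> bounded (UNIV :: 'a::metric_space set)"
  shows "busemann_sup w (w::'a) \<le> 0"
  by (rule busemann_sup_le[OF assms, of 0]) simp

lemma busemann_sup_lipschitz:
  assumes "\<not> bounded (UNIV :: 'a::metric_space set)"
  shows "busemann_sup w y \<le> busemann_sup w (x::'a) + dist x y"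
proof (rule field_le_epsilon)
  fix e :: real assume "e > 0"
  then obtain R where R: "\<And>p. R \<le> dist p w \<Longrightarrow> dist p w - dist p x \<le> busemann_sup w x + e"
    using busemann_sup_lessD[of w x "busemann_sup w x + e"] by auto
  show "busemann_sup w y \<le> busemann_sup w x + dist x y + e"
  proof (rule busemann_sup_le[OF assms, of R])
    fix p assume "R \<le> dist p w"
    from R[OF this] show "dist p w - dist p y \<le> busemann_sup w x + dist x y + e"
      using dist_triangle[of p x y] by (simp add: dist_commute)
  qed
qed

lemma continuous_on_busemann_sup:
  assumes "\<not> bounded (UNIV :: 'a::metric_space set)"
  shows "continuous_on S (busemann_sup (w::'a))"
proof (rule lipschitz_on_continuous_on[of 1], rule lipschitz_onI)
  fix x y :: 'a
  show "dist (busemann_sup w x) (busemann_sup w y) \<le> 1 * dist x y"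
    using busemann_sup_lipschitz[OF assms, of w x y] busemann_sup_lipschitz[OF assms, of w y x]
    by (simp add: dist_real_def dist_commute abs_le_iff)
qed simp

section \<open>Midpoint inequality from uniform smoothness\<close>

lemma busemann_sup_midpoint:
  assumes unb: "\<not> bounded (UNIV :: 'a::metric_space set)"
    and smooth: "uniformly_smooth TYPE('a)"
    and mid: "is_midpoint (m::'a) y z"
  shows "busemann_sup w m \<le> max (busemann_sup w y) (busemann_sup w z)"
proof (cases "y = z")
  \<comment> \<open>Split off because equal endpoints would make \<open>\<epsilon> = L / N\<close>
    zero, where nothing is known about \<rho>.\<close>
  case True
  have "dist y m = dist y z / 2"
    using mid by (simp only: is_midpoint_def)
  with True have "m = y"
    by simp
  then show ?thesis
    by simp
next
  case False
  define L where "L = dist y z"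
  have L: "L > 0"
    using False by (simp add: L_def)
  obtain \<rho> :: "real \<Rightarrow> real" where lim: "((\<lambda>\<epsilon>. \<rho> \<epsilon> / \<epsilon>) \<longlongrightarrow> 0) (at_right 0)"
    and "\<forall>\<epsilon>>0. \<forall>x y z :: 'a. dist y z \<le> \<epsilon> * min (dist x y) (dist x z) \<longrightarrow>
      (\<forall>m. is_midpoint m y z \<longrightarrow> dist x m \<ge> (1 - \<rho> \<epsilon>) * min (dist x y) (dist x z))"
    using smooth unfolding uniformly_smooth_def by (elim exE conjE) (rule that)
  then have \<rho>: "(1 - \<rho> \<epsilon>) * min (dist x y) (dist x z) \<le> dist x m"
    if "\<epsilon> > 0" "dist y z \<le> \<epsilon> * min (dist x y) (dist x z)" for \<epsilon> x
    using mid that by blast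
  show ?thesis
  proof (rule field_le_epsilon)
    fix e :: real assume e: "e > 0"
    define s where "s = max (busemann_sup w y) (busemann_sup w z) + e / 2"
    have "busemann_sup w y < s" "busemann_sup w z < s"
      using e by (auto simp: s_def)
    then obtain R R' where R: "\<And>p. R \<le> dist p w \<Longrightarrow> dist p w - dist p y \<le> s"
      and R': "\<And>p. R' \<le> dist p w \<Longrightarrow> dist p w - dist p z \<le> s"
      by (elim busemann_sup_lessD) blast
    \<comment> \<open>Multiplied by \<open>L\<close>, this threshold becomes \<open>e / 2\<close>,
      the half of \<open>e\<close> not yet spent in \<open>s\<close>.\<close>
    have "\<forall>\<^sub>F \<epsilon> in at_right 0. \<rho> \<epsilon> / \<epsilon> < e / (2 * L)"
      using e L by (intro order_tendstoD(2)[OF lim]) auto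
    then obtain \<delta> where \<delta>: "\<delta> > 0" "\<And>\<epsilon>. 0 < \<epsilon> \<Longrightarrow> \<epsilon> < \<delta> \<Longrightarrow> \<rho> \<epsilon> / \<epsilon> < e / (2 * L)"
      unfolding eventually_at_right_field by blast
    have "busemann_sup w m \<le> s + e / 2"
    \<comment> \<open>Beyond \<open>R\<close> and \<open>R'\<close> both bounds by \<open>s\<close>
      are in force, hence \<open>dist p w - s \<le> N\<close>. The last entry then gives
      \<open>N \<ge> L / \<delta> + 1\<close>, which forces \<open>\<epsilon> = L / N\<close> below
      \<delta>.\<close>
    proof (rule busemann_sup_le[OF unb, of "max (max R R') (L / \<delta> + 1 + s)"])
      fix p assume far: "max (max R R') (L / \<delta> + 1 + s) \<le> dist p w"
      define N where "N = min (dist p y) (dist p z)"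
      define \<epsilon> where "\<epsilon> = L / N"
      have N: "dist p w - s \<le> N"
        using R[of p] R'[of p] far by (auto simp: N_def)
      with far have gt: "L / \<delta> < N"
        by auto
      moreover have "0 < L / \<delta>"
        using L \<delta>(1) by simp
      ultimately have "N > 0"
        by linarith
      then have "\<epsilon> > 0" and LN: "L = \<epsilon> * N"
        using L by (simp_all add: \<epsilon>_def)
      have "\<epsilon> < \<delta>"
        using gt \<open>N > 0\<close> \<delta>(1) by (simp add: \<epsilon>_def divide_less_eq mult.commute)
      have "\<rho> \<epsilon> * N = \<rho> \<epsilon> / \<epsilon> * L"
        using \<open>\<epsilon> > 0\<close> LN by simp
      also have "\<dots> \<le> e / (2 * L) * L"
        using \<delta>(2)[OF \<open>\<epsilon> > 0\<close> \<open>\<epsilon> < \<delta>\<close>] L by (intro mult_right_mono) auto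
      finally have "\<rho> \<epsilon> * N \<le> e / 2"
        using L by simp
      moreover have "(1 - \<rho> \<epsilon>) * N \<le> dist p m"
        using \<rho>[OF \<open>\<epsilon> > 0\<close>, of p] LN by (simp add: N_def L_def)
      ultimately show "dist p w - dist p m \<le> s + e / 2"
        using N by (simp add: algebra_simps)
    qed
    then show "busemann_sup w m \<le> max (busemann_sup w y) (busemann_sup w z) + e"
      by (simp add: s_def)
  qed
qed

section \<open>From midpoints to geodesics\<close>

lemma midpoint_quasi_convex_imp_quasi_convex_real:
  fixes f :: "real \<Rightarrow> real"
  assumes cont: "continuous_on {0..1} f"
    and mid: "\<And>u v. u \<in> {0..1} \<Longrightarrow> v \<in> {0..1} \<Longrightarrow> f ((u + v) / 2) \<le> max (f u) (f v)"
    and t: "t \<in> {0..1}"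
  shows "f t \<le> max (f 0) (f 1)"
proof (rule ccontr)
  \<comment> \<open>The midpoint of the component of \<open>t\<close> in the superlevel set violates \<open>mid\<close>.\<close>
  define c where "c = max (f 0) (f 1)"
  assume "\<not> f t \<le> max (f 0) (f 1)"
  then have ft: "f t > c"
    unfolding c_def by (rule not_le_imp_less)
  have compact: "compact ({a..b} \<inter> f -` {..c})" if "0 \<le> a" "b \<le> 1" for a b
  proof -
    have "continuous_on {a..b} f"
      using that by (intro continuous_on_subset[OF cont]) auto
    then have "closed ({a..b} \<inter> f -` {..c})"
      by (intro continuous_closed_preimage) auto
    moreover have "bounded ({a..b} \<inter> f -` {..c})"
      by (rule bounded_subset[OF bounded_closed_interval]) auto
    ultimately show ?thesis
      by (simp add: compact_eq_bounded_closed)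
  qed
  have 0: "0 \<in> {0..t} \<inter> f -` {..c}" and 1: "1 \<in> {t..1} \<inter> f -` {..c}"
    using t by (auto simp: c_def)
  \<comment> \<open>Ends of that component: \<open>u\<close> is the last point up to
    \<open>t\<close>, and \<open>v\<close> the first from \<open>t\<close> on, with value at most
    \<open>c\<close>.\<close>
  obtain u where u: "u \<in> {0..t}" "f u \<le> c" "\<And>w. w \<in> {0..t} \<Longrightarrow> f w \<le> c \<Longrightarrow> w \<le> u"
    using compact_attains_sup[OF compact[of 0 t]] 0 t
    by (metis Int_iff atLeastAtMost_iff atMost_iff empty_iff order_refl vimage_eq)
  obtain v where v: "v \<in> {t..1}" "f v \<le> c" "\<And>w. w \<in> {t..1} \<Longrightarrow> f w \<le> c \<Longrightarrow> v \<le> w"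
    using compact_attains_inf[OF compact[of t 1]] 1 t
    by (metis Int_iff atLeastAtMost_iff atMost_iff empty_iff order_refl vimage_eq)
  have "u < t" "t < v"
    using u v ft by (metis atLeastAtMost_iff le_less not_less)+
  then have "u < (u + v) / 2" "(u + v) / 2 < v" "(u + v) / 2 \<in> {0..t} \<union> {t..1}"
    using u(1) v(1) by auto
  then have "f ((u + v) / 2) > c"
    using u(3) v(3) by (meson UnE not_less)
  moreover have "f ((u + v) / 2) \<le> max (f u) (f v)"
    using u(1) v(1) t by (intro mid) auto
  ultimately show False
    using u(2) v(2) by linarith
qed

lemma geodesic_endpoints:
  assumes "geodesic_from_to \<gamma> x y"
  shows "\<gamma> 0 = x" "\<gamma> 1 = y"
  using assms by (auto simp: geodesic_from_to_def)

lemma geodesic_dist: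
  assumes "geodesic_from_to \<gamma> x y" "s \<in> {0..1}" "t \<in> {0..1}"
  shows "dist (\<gamma> s) (\<gamma> t) = \<bar>s - t\<bar> * dist x y"
  using assms unfolding geodesic_from_to_def by blast

lemma geodesic_continuous_on:
  assumes "geodesic_from_to \<gamma> x y"
  shows "continuous_on {0..1} \<gamma>"
  using geodesic_dist[OF assms]
  by (intro lipschitz_on_continuous_on[of "dist x y"] lipschitz_onI)
    (auto simp: dist_real_def mult.commute)

lemma geodesic_midpoint:
  assumes "geodesic_from_to \<gamma> x y" "u \<in> {0..1}" "v \<in> {0..1}"
  shows "is_midpoint (\<gamma> ((u + v) / 2)) (\<gamma> u) (\<gamma> v)"
proof -
  have "(u + v) / 2 \<in> {0..1}" "\<bar>u - (u + v) / 2\<bar> = \<bar>u - v\<bar> / 2"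
    "\<bar>(u + v) / 2 - v\<bar> = \<bar>u - v\<bar> / 2"
    using assms(2,3) by (auto simp: field_simps abs_if)
  then show ?thesis
    unfolding is_midpoint_def using geodesic_dist[OF assms(1)] assms(2,3)
    by (metis times_divide_eq_left)
qed

text \<open>Uniform smoothness speaks of midpoints only. Midpoints of parameters on a geodesic are
  metric midpoints, so the one-variable statement applies to \<open>f\<close> composed with the
  geodesic.\<close>

lemma quasi_convexI_midpoint:
  fixes f :: "'a::metric_space \<Rightarrow> real"
  assumes cont: "continuous_on UNIV f"
    and mid: "\<And>m y z. is_midpoint m y z \<Longrightarrow> f m \<le> max (f y) (f z)"
  shows "quasi_convex f"
  unfolding quasi_convex_def
proof (intro allI impI ballI)
  fix \<gamma> :: "real \<Rightarrow> 'a" and x y and t :: real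
  assume \<gamma>: "geodesic_from_to \<gamma> x y" and t: "t \<in> {0..1}"
  have "continuous_on {0..1} (\<lambda>t. f (\<gamma> t))"
    by (rule continuous_on_compose2[OF cont geodesic_continuous_on[OF \<gamma>]]) simp
  from midpoint_quasi_convex_imp_quasi_convex_real[OF this mid[OF geodesic_midpoint[OF \<gamma>]] t]
  show "f (\<gamma> t) \<le> max (f (\<gamma> 0)) (f (\<gamma> 1))" .
qed

section \<open>Limits of points on geodesics towards infinity\<close>

lemma geodesic_point:
  assumes "geodesic_from_to \<gamma> x y" "0 \<le> t" "t \<le> dist x y"
  obtains u where "u \<in> {0..1}" "dist x (\<gamma> u) = t" "dist (\<gamma> u) y = dist x y - t"
proof (cases "x = y")
  case True
  with assms(2,3) have "t = 0"
    by simp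
  moreover have "\<gamma> 0 = x"
    using geodesic_endpoints[OF assms(1)] by simp
  ultimately show thesis
    using that[of 0] by simp
next
  case False
  define u where "u = t / dist x y"
  have u: "u \<in> {0..1}" "u * dist x y = t"
    using False assms(2,3) by (simp_all add: u_def)
  have "dist (\<gamma> 0) (\<gamma> u) = \<bar>0 - u\<bar> * dist x y" "dist (\<gamma> u) (\<gamma> 1) = \<bar>u - 1\<bar> * dist x y"
    using geodesic_dist[OF assms(1)] u(1) by simp_all
  moreover have "\<bar>0 - u\<bar> = u" "\<bar>u - 1\<bar> = 1 - u"
    using u(1) by simp_all
  ultimately have "dist x (\<gamma> u) = u * dist x y" "dist (\<gamma> u) y = (1 - u) * dist x y"
    using geodesic_endpoints[OF assms(1)] by (simp_all only:)
  with u(2) have "dist x (\<gamma> u) = t" "dist (\<gamma> u) y = dist x y - t"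
    by (simp_all only: left_diff_distrib mult_1_left)
  with u(1) show thesis
    by (rule that)
qed

text \<open>For every \<open>p\<close> the difference \<open>dist p w - dist p q\<close> is
  1-Lipschitz in \<open>q\<close>. Replacing the points of \<open>C\<close> by a subsequential limit
  therefore costs an error that tends to 0, uniformly in \<open>p\<close>.\<close>

lemma busemann_sup_ge_accumulation:
  fixes C :: "'a::metric_space set"
  assumes C: "compact C"
    and pq: "\<And>R e. e > 0 \<Longrightarrow> \<exists>p. \<exists>q\<in>C. R \<le> dist p w \<and> c - e \<le> dist p w - dist p q"
  obtains q where "q \<in> C" "c \<le> busemann_sup w q"
proof -
  have "\<exists>p. \<exists>q\<in>C. real n \<le> dist p w \<and> c - 1 / Suc n \<le> dist p w - dist p q" for n
    by (rule pq) simp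
  then obtain p q where q: "\<And>n. q n \<in> C" and far: "\<And>n. real n \<le> dist (p n) w"
    and le: "\<And>n. c - 1 / Suc n \<le> dist (p n) w - dist (p n) (q n)"
    by metis
  obtain l r where l: "l \<in> C" and r: "strict_mono r" and lim: "(q \<circ> r) \<longlonglongrightarrow> l"
    using C q unfolding compact_def by metis
  have "c \<le> busemann_sup w l"
  proof (rule ccontr)
    assume "\<not> c \<le> busemann_sup w l"
    then obtain s where s: "busemann_sup w l < s" "s < c"
      using dense[of "busemann_sup w l" c] by auto
    obtain R where R: "\<And>p. R \<le> dist p w \<Longrightarrow> dist p w - dist p l \<le> s"
      using busemann_sup_lessD[OF s(1)] by blast
    have "(\<lambda>n. c - 1 / Suc (r n) - dist ((q \<circ> r) n) l) \<longlonglongrightarrow> c - 0 - dist l l"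
      using LIMSEQ_subseq_LIMSEQ[OF lim_1_over_n[THEN LIMSEQ_Suc] r]
      by (intro tendsto_intros lim) (simp add: comp_def)
    then have "\<forall>\<^sub>F n in sequentially. s < c - 1 / Suc (r n) - dist ((q \<circ> r) n) l"
      using s(2) by (intro order_tendstoD(1)) auto
    \<comment> \<open>Since \<open>n \<le> r n\<close>, the points \<open>p (r n)\<close> still
      leave every ball around \<open>w\<close>.\<close>
    moreover have "\<forall>\<^sub>F n in sequentially. R \<le> real n"
      using filterlim_real_sequentially by (simp add: filterlim_at_top)
    ultimately have "\<forall>\<^sub>F n in sequentially. False"
    proof eventually_elim
      case (elim n)
      have "R \<le> dist (p (r n)) w"
        using elim(2) far[of "r n"] seq_suble[OF r, of n] by linarith
      from R[OF this] show False
        using elim(1) le[of "r n"] dist_triangle[of "p (r n)" l "q (r n)"]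
          dist_triangle[of "p (r n)" "q (r n)" l] by (simp add: dist_commute)
    qed
    then show False
      by simp
  qed
  with l that show thesis
    by blast
qed

text \<open>Moving a distance \<open>t\<close> from \<open>x\<close> along a geodesic to
  \<open>p\<close> shortens the distance to \<open>p\<close> by exactly \<open>t\<close>, hence
  raises the difference by \<open>t\<close>. Properness makes the sphere compact, so a limit over
  far \<open>p\<close> exists.\<close>

lemma busemann_sup_escape:
  fixes x :: "'a::metric_space"
  assumes unb: "\<not> bounded (UNIV :: 'a set)"
    and proper: "proper_space TYPE('a)"
    and geo: "geodesic_space TYPE('a)"
    and t: "0 \<le> t"
  obtains y where "dist x y = t" "busemann_sup w x + t \<le> busemann_sup w y"
proof -
  have "closed (sphere x t)"
    by (auto simp: sphere_def intro!: closed_Collect_eq continuous_intros)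
  moreover have "bounded (sphere x t)"
    by (rule bounded_subset[OF bounded_cball sphere_cball])
  ultimately have "compact (sphere x t)"
    using proper by (simp add: proper_space_def)
  then obtain y where "y \<in> sphere x t" "busemann_sup w x + t \<le> busemann_sup w y"
  proof (rule busemann_sup_ge_accumulation)
    fix R e :: real assume "e > 0"
    then have "\<not> busemann_sup w x \<le> busemann_sup w x - e"
      by simp
    \<comment> \<open>Without such a \<open>p\<close>, the value at \<open>x\<close> would be at
      most itself minus \<open>e\<close>. The radius \<open>t + dist x w\<close> ensures
      \<open>t \<le> dist x p\<close>, so the geodesic is long enough.\<close>
    with busemann_sup_le[OF unb, of "max R (t + dist x w)" w x "busemann_sup w x - e"]
    obtain p where far: "max R (t + dist x w) \<le> dist p w"
      and p: "busemann_sup w x - e < dist p w - dist p x"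
      by force
    obtain \<gamma> where \<gamma>: "geodesic_from_to \<gamma> x p"
      using geo unfolding geodesic_space_def by blast
    have "t \<le> dist x p"
      using far dist_triangle[of p w x] by (simp add: dist_commute)
    then obtain u where "dist x (\<gamma> u) = t" "dist (\<gamma> u) p = dist x p - t"
      using geodesic_point[OF \<gamma> t] by metis
    with far p show "\<exists>p. \<exists>q\<in>sphere x t. R \<le> dist p w \<and>
        busemann_sup w x + t - e \<le> dist p w - dist p q"
      by (intro exI[of _ p] bexI[of _ "\<gamma> u"]) (auto simp: dist_commute)
  qed
  with that show thesis
    by simp
qed

section \<open>Boundedness of sublevel sets and emptiness of the interior of the minimum set\<close>

lemma bounded_busemann_sup_sublevel:
  assumes unb: "\<not> bounded (UNIV :: 'a::metric_space set)"
    and proper: "proper_space TYPE('a)"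
    and geo: "geodesic_space TYPE('a)"
    and qc: "quasi_convex (busemann_sup (w::'a))"
  shows "bounded (busemann_sup w -` {..s})"
proof (rule ccontr)
  assume nb: "\<not> bounded (busemann_sup w -` {..s})"
  \<comment> \<open>The maximum with 0 puts \<open>w\<close> itself in the sublevel set of
    \<open>S\<close>, so quasi-convexity keeps geodesics from \<open>w\<close> to \<open>p\<close>
    inside it. Points at distance \<open>S + 1\<close> then yield a limit of value at least
    \<open>S + 1\<close>, while values on \<open>C\<close> are at most \<open>S\<close>.\<close>
  define S where "S = max s 0"
  define C where "C = {q \<in> cball w (S + 1). busemann_sup w q \<le> S}"
  have "C = cball w (S + 1) \<inter> busemann_sup w -` {..S}"
    by (auto simp: C_def)
  then have "closed C"
    using closed_vimage[OF closed_atMost continuous_on_busemann_sup[OF unb]]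
    by (simp add: closed_Int)
  moreover have "bounded C"
    unfolding C_def by (rule bounded_subset[OF bounded_cball]) auto
  ultimately have "compact C"
    using proper by (simp add: proper_space_def)
  then obtain q where "q \<in> C" "S + 1 \<le> busemann_sup w q"
  proof (rule busemann_sup_ge_accumulation)
    fix R e :: real assume "e > 0"
    obtain p where p: "busemann_sup w p \<le> s" "max R (S + 1) < dist w p"
      using nb unfolding bounded_def by (metis atMost_iff not_le vimage_eq)
    obtain \<gamma> where \<gamma>: "geodesic_from_to \<gamma> w p"
      using geo unfolding geodesic_space_def by blast
    then obtain u where u: "u \<in> {0..1}" "dist w (\<gamma> u) = S + 1" "dist (\<gamma> u) p = dist w p - (S + 1)"
      using geodesic_point[OF \<gamma>, of "S + 1"] p(2) by (auto simp: S_def)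
    have "busemann_sup w (\<gamma> u) \<le> max (busemann_sup w (\<gamma> 0)) (busemann_sup w (\<gamma> 1))"
      using qc \<gamma> u(1) unfolding quasi_convex_def by blast
    also have "\<dots> \<le> S"
      using geodesic_endpoints[OF \<gamma>] p(1) busemann_sup_base_le[OF unb, of w]
      by (auto simp: S_def)
    finally have "\<gamma> u \<in> C"
      using u(2) by (simp add: C_def)
    with u p(2) \<open>e > 0\<close>
    show "\<exists>p. \<exists>q\<in>C. R \<le> dist p w \<and> S + 1 - e \<le> dist p w - dist p q"
      by (intro exI[of _ p] bexI[of _ "\<gamma> u"]) (auto simp: dist_commute)
  qed
  then show False
    by (simp add: C_def)
qed

theorem theorem3p8:
  assumes "\<not> compact (UNIV :: 'a::metric_space set)"
    and "uniformly_smooth TYPE('a)"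
    and "locally compact (UNIV :: 'a set)"
    and "proper_space TYPE('a)"
    and "geodesic_space TYPE('a)"
  shows "\<exists>b :: 'a \<Rightarrow> real. quasi_convex b \<and> exhaustion_function b \<and>
           (\<exists>m. m \<in> range b \<and> (\<forall>x. m \<le> b x) \<and> interior (b -` {m}) = {})"
proof -
  have unb: "\<not> bounded (UNIV :: 'a set)"
    using assms(1,4) by (auto simp: proper_space_def)
  define w :: 'a where "w = undefined"
  define b where "b = busemann_sup w"
  have cont: "continuous_on S b" for S
    unfolding b_def by (rule continuous_on_busemann_sup[OF unb])
  have qc: "quasi_convex b"
    using cont busemann_sup_midpoint[OF unb assms(2)]
    unfolding b_def by (rule quasi_convexI_midpoint)
  have sublevel: "compact (b -` {..s})" for s
    using assms(4) bounded_busemann_sup_sublevel[OF unb assms(4,5) qc[unfolded b_def]]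
      closed_vimage[OF closed_atMost cont]
    by (simp add: proper_space_def b_def)
  \<comment> \<open>The sublevel set of \<open>b w\<close> is compact and contains \<open>w\<close>;
    outside it \<open>b\<close> exceeds \<open>b w\<close>, so its minimum is global.\<close>
  obtain x where x: "b x \<le> b w" "\<And>y. b y \<le> b w \<Longrightarrow> b x \<le> b y"
    using continuous_attains_inf[OF sublevel[of "b w"] _ cont] by fastforce
  then have min: "b x \<le> b y" for y
    by (meson linear order_trans)
  have "interior (b -` {b x}) = {}"
  proof (rule ccontr)
    assume "interior (b -` {b x}) \<noteq> {}"
    \<comment> \<open>A closed ball is taken because the escaping point lies at distance exactly
      \<open>e\<close> from \<open>z\<close>, where \<open>b\<close> has grown by at least
      \<open>e\<close>.\<close>
    then obtain z e where e: "e > 0" "cball z e \<subseteq> b -` {b x}"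
      by (auto simp: mem_interior_cball)
    obtain y where "dist z y = e" "b z + e \<le> b y"
      using busemann_sup_escape[OF unb assms(4,5), of e z w] e(1) by (auto simp: b_def)
    moreover from this have "z \<in> cball z e" "y \<in> cball z e"
      using e(1) by auto
    then have "b z = b x" "b y = b x"
      using e(2) by blast+
    ultimately show False
      using e(1) by simp
  qed
  with qc sublevel cont min show ?thesis
    unfolding exhaustion_function_def by blast
qed

end
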